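(* Let $\mathbb{F}_q$ be a finite field with $q$ elements, let $n\ge 1$ be an integer, let $b\in\mathbb{F}_q^*$, let $\psi:\mathbb{F}_q\to\mathbb{C}^*$ be a nontrivial additive character, and let $\chi_1,\ldots,\chi_{n+1}:\mathbb{F}_q^*\to\mathbb{C}^*$ be multiplicative characters. Let $S_n(\chi,b)$ be the twisted inverted $n$-variable Kloosterman sum $$S_n(\chi,b)=\sum_{\substack{x_1,\ldots,x_{n+1}\in\mathbb{F}_q^*\\ x_1\cdots x_{n+1}=b\\ x_1+\cdots+x_{n+1}\neq 0}}\chi_1(x_1)\cdots\chi_{n+1}(x_{n+1})\,\psi\left(\frac{1}{x_1+\cdots+x_{n+1}}\right).$$ If $\chi_1=\cdots=\chi_{n+1}$, then $$\left|S_n(\chi,b)+\frac{(q-1)^{n}}{q}\chi_1(b)\right|\le q^{\frac{n+1}{2}}.$$ If $\chi_i\neq\chi_j$ for some $i\neq j$, then $$\left|S_n(\chi,b)\right|\le q^{\frac{n+1}{2}}.$$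
   Context: A multiplicative character is a group homomorphism $\mathbb{F}_q^*\to\mathbb{C}^*$ (possibly trivial); an additive character is a group homomorphism $(\mathbb{F}_q,+)\to\mathbb{C}^*$. *)

theory Defs
  imports Complex_Main "HOL-Library.FuncSet" "HOL-Library.Cardinality"
begin

text \<open>
  The field with \<open>q\<close> elements is a type \<open>'a\<close> of class \<open>{field, finite}\<close>, so \<open>q = CARD('a)\<close>.
  A homomorphism from \<open>F\<^sub>q\<^sup>*\<close> to \<open>C\<^sup>*\<close> is a total function \<open>'a \<Rightarrow> complex\<close> whose value at 0
  is irrelevant; equality of such characters therefore means agreement on nonzero elements.
\<close>

definition multiplicative_character :: "('a::field \<Rightarrow> complex) \<Rightarrow> bool" where
  "multiplicative_character chi \<longleftrightarrow>
     (\<forall>x. x \<noteq> 0 \<longrightarrow> chi x \<noteq> 0) \<and>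
     (\<forall>x y. x \<noteq> 0 \<longrightarrow> y \<noteq> 0 \<longrightarrow> chi (x * y) = chi x * chi y)"

definition same_character :: "('a::field \<Rightarrow> complex) \<Rightarrow> ('a \<Rightarrow> complex) \<Rightarrow> bool" where
  "same_character chi chi' \<longleftrightarrow> (\<forall>x. x \<noteq> 0 \<longrightarrow> chi x = chi' x)"

definition additive_character :: "('a::field \<Rightarrow> complex) \<Rightarrow> bool" where
  "additive_character \<psi> \<longleftrightarrow>
     (\<forall>x. \<psi> x \<noteq> 0) \<and> (\<forall>x y. \<psi> (x + y) = \<psi> x * \<psi> y)"

definition nontrivial_character :: "('a::field \<Rightarrow> complex) \<Rightarrow> bool" where
  "nontrivial_character \<psi> \<longleftrightarrow> (\<exists>x. \<psi> x \<noteq> 1)"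

text \<open>
  Tuples \<open>(x\<^sub>1, \<dots>, x\<^sub>n\<^sub>+\<^sub>1)\<close> are extensional functions on \<open>{1..n+1}\<close>, so that
  each tuple is counted exactly once.
\<close>

definition inverted_kloosterman_sum ::
    "nat \<Rightarrow> ('a::{field,finite} \<Rightarrow> complex) \<Rightarrow> (nat \<Rightarrow> 'a \<Rightarrow> complex) \<Rightarrow> 'a \<Rightarrow> complex" where
  "inverted_kloosterman_sum n \<psi> chi b =
     (\<Sum>x\<in>{x \<in> {1..n+1} \<rightarrow>\<^sub>E (UNIV - {0}).
             (\<Prod>i\<in>{1..n+1}. x i) = b \<and> (\<Sum>i\<in>{1..n+1}. x i) \<noteq> 0}.
        (\<Prod>i\<in>{1..n+1}. chi i (x i)) * \<psi> (1 / (\<Sum>i\<in>{1..n+1}. x i)))"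

end

theory Submission
  imports Defs "HOL-Algebra.Algebraic_Closure_Type"
begin

text \<open>
  The estimate follows, by Fourier analysis on both the additive and the multiplicative group of
  the field, from the bound \<open>sqrt q\<close> for the absolute value of Gauss sums.

  Write \<open>N = q - 1\<close>. Expanding the function \<open>s \<mapsto> \<psi> (1 / s)\<close> (extended by \<open>0\<close> at \<open>s = 0\<close>) into
  additive characters gives \<open>\<psi> (1 / s) = (1 / q) * (\<Sum>l. K l * \<psi> (l * s))\<close> with the transform
  \<open>K l = (\<Sum>t \<noteq> 0. \<psi> (1 / t - l * t))\<close> (\<open>inversion_formula\<close>). The condition
  \<open>x\<^sub>1 \<cdots> x\<^sub>n\<^sub>+\<^sub>1 = b\<close> is detected by a family \<open>E\<^sub>0, \<dots>, E\<^sub>N\<^sub>-\<^sub>1\<close> of multiplicative characters with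
  \<open>(\<Sum>k. E\<^sub>k x) = N\<close> for \<open>x = 1\<close> and \<open>0\<close> for other nonzero \<open>x\<close> (\<open>orthogonal_character_family\<close>).
  The sum over tuples then factors, so that, with
  \<open>G(\<chi>, l) = (\<Sum>x \<noteq> 0. \<chi> x * \<psi> (l * x))\<close>,

  \<open>q * N * S = (\<Sum>k. E\<^sub>k (1 / b) * (\<Sum>l. K l * (\<Prod>i. G(\<chi>\<^sub>i E\<^sub>k, l))))\<close>.

  The terms with \<open>l = 0\<close> are explicit: \<open>K 0 = -1\<close>, and \<open>G(\<chi>\<^sub>i E\<^sub>k, 0)\<close> is \<open>N\<close> or \<open>0\<close> according to
  whether \<open>\<chi>\<^sub>i E\<^sub>k\<close> is trivial. If two of the \<open>\<chi>\<^sub>i\<close> differ, the product over \<open>i\<close> always vanishes;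
  if all agree, these terms give the main term \<open>- (N ^ n / q) * \<chi>\<^sub>1 b\<close> of \<open>S\<close>.

  For \<open>l \<noteq> 0\<close> one has \<open>G(\<chi>, l) = G(\<chi>, 1) / \<chi> l\<close>. Hence the inner sum over \<open>l \<noteq> 0\<close> is
  \<open>\<Prod>i. G(\<chi>\<^sub>i E\<^sub>k, 1)\<close> times the Mellin transform of \<open>K\<close> at \<open>\<rho> = 1 / (\<Prod>i. \<chi>\<^sub>i E\<^sub>k)\<close>,
  and that transform is \<open>G(\<rho>, 1)\<^sup>2 / \<rho> (-1)\<close> (\<open>inversion_transform_mellin\<close>). These are
  \<open>n + 3\<close> Gauss sums of absolute value at most \<open>sqrt q\<close>, so each of the \<open>N\<close> values of \<open>k\<close>
  contributes at most \<open>q powr ((n + 3) / 2)\<close>; division by \<open>q * N\<close> yields the claim.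
\<close>

section \<open>Multiplicative characters of a finite field\<close>

text \<open>
  Cyclicity of the unit group, carried over from rings with explicit carrier to the type class.
  The powers of \<open>g\<close> below its order \<open>d\<close> run through the nonzero elements exactly once, which
  identifies \<open>d\<close> with \<open>q - 1\<close>.
\<close>

lemma finite_field_generator:
  obtains g :: "'a::{field,finite}" where "g \<noteq> 0" and "\<And>x. x \<noteq> 0 \<Longrightarrow> \<exists>i::nat. x = g ^ i"
    and "\<And>i::nat. g ^ i = 1 \<longleftrightarrow> (CARD('a) - 1) dvd i"
proof -
  define R where "R = (ring_of_type_algebra :: 'a ring)"
  interpret R: field R
    unfolding R_def by (rule field_from_type_algebra)
  have fin: "finite (carrier R)" by simp
  have car: "carrier (Multiplicative_Group.mult_of R) = UNIV - {0}"
    by (auto simp: R_def ring_of_type_algebra_def)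
  have pow: "x [^]\<^bsub>R\<^esub> i = x ^ i" for x :: 'a and i :: nat
    by (induction i) (auto simp: R_def ring_of_type_algebra_def nat_pow_def)
  interpret G: group "Multiplicative_Group.mult_of R" rewrites
      "([^]\<^bsub>Multiplicative_Group.mult_of R\<^esub>) = (([^]\<^bsub>R\<^esub>) :: _ \<Rightarrow> nat \<Rightarrow> _)"
      and "\<one>\<^bsub>Multiplicative_Group.mult_of R\<^esub> = \<one>\<^bsub>R\<^esub>"
    by (rule R.field_mult_group) (simp_all add: fun_eq_iff nat_pow_def)
  obtain g where g: "g \<in> carrier (Multiplicative_Group.mult_of R)"
    "carrier (Multiplicative_Group.mult_of R) = {g [^]\<^bsub>R\<^esub> i | i::nat. i \<in> UNIV}"
    using R.finite_field_mult_group_has_gen[OF fin] by blast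
  have g0: "g \<noteq> 0" using g(1) unfolding car by simp
  have surj: "\<exists>i::nat. x = g ^ i" if "x \<noteq> 0" for x
    using that g(2) unfolding car by (auto simp: pow)
  define d where "d = G.ord g"
  have one: "\<one>\<^bsub>R\<^esub> = 1" by (simp add: R_def ring_of_type_algebra_def)
  have d: "g ^ i = 1 \<longleftrightarrow> d dvd i" for i :: nat
    using G.pow_eq_id[OF g(1), of i] by (simp add: pow one d_def)
  have d0: "d > 0"
    using G.ord_ge_1[OF _ g(1)] by (simp add: d_def)
  have "(\<lambda>i. g ^ i) ` {..<d} = UNIV - {0}"
  proof (intro equalityI subsetI)
    fix x :: 'a assume "x \<in> UNIV - {0}"
    then obtain i :: nat where i: "x = g ^ i" using surj by auto
    have "g ^ i = g ^ (d * (i div d) + i mod d)" by simp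
    also have "\<dots> = g ^ (i mod d)" using d[of "d * (i div d)"] by (simp only: power_add) simp
    finally show "x \<in> (\<lambda>i. g ^ i) ` {..<d}" using i d0 by auto
  qed (use g0 in auto)
  moreover have "inj_on (\<lambda>i. g ^ i) {..<d}"
  proof (rule linorder_inj_onI)
    fix i j :: nat assume ij: "i < j" "i \<in> {..<d}" "j \<in> {..<d}"
    show "g ^ i \<noteq> g ^ j"
    proof
      assume "g ^ i = g ^ j"
      also have "\<dots> = g ^ i * g ^ (j - i)" using ij by (simp flip: power_add)
      finally have "g ^ (j - i) = 1" using g0 by simp
      then have "d dvd (j - i)" using d by simp
      with ij show False by (auto dest: dvd_imp_le)
    qed
  qed auto
  ultimately have "card {..<d} = card (UNIV - {0::'a})"
    by (metis card_image)
  then have "d = CARD('a) - 1" by (simp add: card_Diff_subset)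
  with g0 surj d show ?thesis using that by blast
qed

text \<open>
  With a generator \<open>g\<close> and a primitive root of unity \<open>w\<close> of order \<open>q - 1\<close>, the characters are
  \<open>g ^ j \<mapsto> w ^ (j * k)\<close>, and their sum at a fixed point is a geometric series.
\<close>

lemma orthogonal_character_family:
  obtains E :: "nat \<Rightarrow> 'a::{field,finite} \<Rightarrow> complex"
  where "\<And>k. multiplicative_character (E k)"
    and "\<And>x. x \<noteq> 0 \<Longrightarrow>
           (\<Sum>k<CARD('a) - 1. E k x) = (if x = 1 then of_nat (CARD('a) - 1) else 0)"
proof -
  define N where "N = CARD('a) - 1"
  have "card {0, 1::'a} \<le> CARD('a)" by (intro card_mono) auto
  then have N0: "N > 0" by (simp add: N_def)
  obtain g :: 'a where g: "g \<noteq> 0" and surj: "\<And>x. x \<noteq> 0 \<Longrightarrow> \<exists>i::nat. x = g ^ i"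
    and ord: "\<And>i::nat. g ^ i = 1 \<longleftrightarrow> N dvd i"
    using finite_field_generator unfolding N_def by blast
  define w where "w = cis (2 * pi / of_nat N)"
  have w_eq_1: "w ^ i = 1 \<longleftrightarrow> N dvd i" for i
  proof -
    have wN: "w ^ N = 1" using N0 by (simp add: w_def DeMoivre)
    have "w ^ i = w ^ (N * (i div N) + i mod N)" by simp
    also have "\<dots> = w ^ (i mod N)" by (simp only: power_add power_mult wN) simp
    finally have *: "w ^ i = w ^ (i mod N)" .
    have inj: "inj_on (\<lambda>k. cis (2 * pi * real k / real N)) {..<N}"
      using bij_betw_roots_unity[OF N0] by (simp add: bij_betw_def)
    have "w ^ k = cis (2 * pi * real k / real N)" for k
      by (simp add: w_def DeMoivre field_simps)
    then have "w ^ (i mod N) = w ^ 0 \<longleftrightarrow> i mod N = 0"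
      using inj_on_eq_iff[OF inj, of "i mod N" 0] N0 by simp
    then show ?thesis using * by (simp add: dvd_eq_mod_eq_0)
  qed
  (* the discrete logarithm to base g, determined modulo N *)
  define l where "l x = (SOME i. x = g ^ i)" for x
  have l: "g ^ l x = x" if "x \<noteq> 0" for x
    using someI_ex[OF surj[OF that]] by (simp add: l_def)
  define E where "E k x = (w ^ l x) ^ k" for k x
  (* w has the same order as g, so powers of w depend only on the corresponding power of g *)
  have transfer: "w ^ i = w ^ j" if "g ^ i = g ^ j" for i j
    using that
  proof (induction i j rule: linorder_wlog)
    case (le i j)
    have "g ^ j = g ^ i * g ^ (j - i)" using le(1) by (simp flip: power_add)
    then have "g ^ (j - i) = 1" using le g by simp
    then have "w ^ (j - i) = 1" using ord w_eq_1 by simp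
    moreover have "w ^ j = w ^ i * w ^ (j - i)" using le(1) by (simp flip: power_add)
    ultimately show ?case by simp
  qed simp
  have "multiplicative_character (E k)" for k
  proof -
    have "w ^ l (x * y) = w ^ l x * w ^ l y" if "x \<noteq> 0" "y \<noteq> 0" for x y
      using transfer[of "l (x * y)" "l x + l y"] that by (simp add: l power_add)
    then show ?thesis
      by (simp add: multiplicative_character_def E_def power_mult_distrib w_def)
  qed
  moreover have "(\<Sum>k<N. E k x) = (if x = 1 then of_nat N else 0)" if "x \<noteq> 0" for x
  proof (cases "x = 1")
    case True
    then have "w ^ l x = 1" using l[of x] ord w_eq_1 by simp
    then show ?thesis using True by (simp add: E_def)
  next
    case False
    then have "w ^ l x \<noteq> 1" using l[OF that] ord w_eq_1 by metis
    moreover have "(w ^ l x) ^ N = 1" using w_eq_1 by (simp flip: power_mult)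
    ultimately show ?thesis using False by (simp add: E_def sum_gp_strict)
  qed
  ultimately show ?thesis using that[of E] by (simp add: N_def)
qed


lemma sum_nonzero_scale:
  fixes a :: "'a::{field,finite}"
  assumes "a \<noteq> 0"
  shows "(\<Sum>x\<in>UNIV - {0}. f (a * x)) = (\<Sum>x\<in>UNIV - {0}. f x)"
  by (rule sum.reindex_bij_witness[of _ "\<lambda>x. x / a" "\<lambda>x. a * x"]) (use assms in auto)

lemma sum_nonzero_inverse:
  "(\<Sum>x\<in>UNIV - {0::'a::{field,finite}}. f (1 / x)) = (\<Sum>x\<in>UNIV - {0}. f x)"
  by (rule sum.reindex_bij_witness[of _ "\<lambda>x. 1 / x" "\<lambda>x. 1 / x"]) auto

lemma multiplicative_character_times:
  assumes "multiplicative_character chi" "x \<noteq> 0" "y \<noteq> 0"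
  shows "chi (x * y) = chi x * chi y"
  using assms unfolding multiplicative_character_def by blast

lemma multiplicative_character_nonzero:
  assumes "multiplicative_character chi" "x \<noteq> 0"
  shows "chi x \<noteq> 0"
  using assms unfolding multiplicative_character_def by blast

lemma multiplicative_character_1:
  assumes "multiplicative_character chi"
  shows "chi 1 = 1"
  using multiplicative_character_times[OF assms, of 1 1]
    multiplicative_character_nonzero[OF assms, of 1] by simp

lemma multiplicative_character_inverse:
  assumes "multiplicative_character chi" "x \<noteq> 0"
  shows "chi (1 / x) = 1 / chi x"
proof -
  have "chi x * chi (1 / x) = chi (x * (1 / x))"
    using multiplicative_character_times[OF assms(1), of x "1 / x"] assms(2) by simp
  also have "\<dots> = 1" using assms multiplicative_character_1 by simp
  finally have "chi x * chi (1 / x) = 1" .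
  moreover have "chi x \<noteq> 0" using assms by (rule multiplicative_character_nonzero)
  ultimately show ?thesis by (simp add: nonzero_eq_divide_eq mult.commute)
qed

lemma multiplicative_character_mult:
  assumes "multiplicative_character chi" "multiplicative_character eta"
  shows "multiplicative_character (\<lambda>x. chi x * eta x)"
  using assms by (simp add: multiplicative_character_def)

lemma multiplicative_character_reciprocal_prod:
  assumes "\<And>i. i \<in> I \<Longrightarrow> multiplicative_character (chi i)"
  shows "multiplicative_character (\<lambda>x. 1 / (\<Prod>i\<in>I. chi i x))"
  using assms
proof (induction I rule: infinite_finite_induct)
  case (insert i I)
  then have "multiplicative_character (\<lambda>x. 1 / chi i x)"
    by (simp add: multiplicative_character_def)
  from multiplicative_character_mult[OF this insert.IH] insert
  show ?case by simp
qed (simp_all add: multiplicative_character_def)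

lemma multiplicative_character_prod:
  assumes "multiplicative_character chi" "\<And>i. i \<in> I \<Longrightarrow> f i \<noteq> 0"
  shows "chi (\<Prod>i\<in>I. f i) = (\<Prod>i\<in>I. chi (f i))"
  using assms(2)
proof (induction I rule: infinite_finite_induct)
  case (insert i I)
  then have "(\<Prod>i\<in>I. f i) \<noteq> 0" by (cases "finite I") auto
  then show ?case
    using insert by (simp add: multiplicative_character_times[OF assms(1)])
qed (use assms(1) multiplicative_character_1 in auto)

text \<open>
  Translation by \<open>x\<close> permutes the group and multiplies the positive sum of all \<open>norm (chi y)\<close>
  by \<open>norm (chi x)\<close>. The same argument works for additive characters.
\<close>

lemma norm_multiplicative_character:
  fixes chi :: "'a::{field,finite} \<Rightarrow> complex"
  assumes "multiplicative_character chi" "x \<noteq> 0"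
  shows "norm (chi x) = 1"
proof -
  let ?S = "\<Sum>y\<in>UNIV - {0}. norm (chi y)"
  have "?S = (\<Sum>y\<in>UNIV - {0}. norm (chi (x * y)))"
    using sum_nonzero_scale[OF assms(2), of "\<lambda>y. norm (chi y)"] by simp
  also have "\<dots> = norm (chi x) * ?S"
    using assms(2)
    by (simp add: multiplicative_character_times[OF assms(1)] norm_mult sum_distrib_left)
  finally have "?S = norm (chi x) * ?S" .
  moreover have "?S > 0"
    using multiplicative_character_1[OF assms(1)] by (intro sum_pos2[of _ 1]) auto
  ultimately show ?thesis by simp
qed

lemma sum_multiplicative_character:
  fixes chi :: "'a::{field,finite} \<Rightarrow> complex"
  assumes "multiplicative_character chi"
  shows "(\<Sum>x\<in>UNIV - {0}. chi x) =
           (if \<forall>x. x \<noteq> 0 \<longrightarrow> chi x = 1 then of_nat (CARD('a) - 1) else 0)"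
proof (cases "\<forall>x. x \<noteq> 0 \<longrightarrow> chi x = 1")
  case True
  then have "(\<Sum>x\<in>UNIV - {0}. chi x) = (\<Sum>x\<in>UNIV - {0::'a}. 1)"
    by (intro sum.cong) auto
  then show ?thesis using True by (simp add: card_Diff_subset)
next
  case False
  then obtain a where a: "a \<noteq> 0" "chi a \<noteq> 1" by blast
  have "(\<Sum>x\<in>UNIV - {0}. chi x) = (\<Sum>x\<in>UNIV - {0}. chi (a * x))"
    using sum_nonzero_scale[OF a(1), of chi] by simp
  also have "\<dots> = chi a * (\<Sum>x\<in>UNIV - {0}. chi x)"
    using a(1) by (simp add: multiplicative_character_times[OF assms] sum_distrib_left)
  finally have "(\<Sum>x\<in>UNIV - {0}. chi x) = 0" using a(2) by simp
  then show ?thesis using a by auto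
qed

section \<open>Additive characters\<close>

lemma additive_character_add:
  assumes "additive_character \<psi>"
  shows "\<psi> (x + y) = \<psi> x * \<psi> y"
  using assms unfolding additive_character_def by blast

lemma additive_character_0:
  assumes "additive_character \<psi>"
  shows "\<psi> 0 = 1"
  using assms additive_character_add[OF assms, of 0 0] by (simp add: additive_character_def)

lemma additive_character_sum:
  assumes "additive_character \<psi>"
  shows "\<psi> (\<Sum>i\<in>I. f i) = (\<Prod>i\<in>I. \<psi> (f i))"
  by (induction I rule: infinite_finite_induct)
     (simp_all add: additive_character_0[OF assms] additive_character_add[OF assms])

lemma norm_additive_character:
  fixes \<psi> :: "'a::{field,finite} \<Rightarrow> complex"
  assumes "additive_character \<psi>"
  shows "norm (\<psi> x) = 1"
proof -
  let ?S = "\<Sum>y\<in>UNIV. norm (\<psi> y)"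
  have "?S = (\<Sum>y\<in>UNIV. norm (\<psi> (x + y)))"
    by (rule sum.reindex_bij_witness[of _ "\<lambda>y. x + y" "\<lambda>y. y - x"]) auto
  also have "\<dots> = norm (\<psi> x) * ?S"
    by (simp add: additive_character_add[OF assms] norm_mult sum_distrib_left)
  finally have "?S = norm (\<psi> x) * ?S" .
  moreover have "?S > 0"
    using assms by (intro sum_pos) (auto simp: additive_character_def)
  ultimately show ?thesis by simp
qed

lemma cnj_additive_character:
  fixes \<psi> :: "'a::{field,finite} \<Rightarrow> complex"
  assumes "additive_character \<psi>"
  shows "cnj (\<psi> x) = \<psi> (- x)"
proof -
  have "\<psi> x * cnj (\<psi> x) = 1"
    using norm_additive_character[OF assms, of x] by (simp add: complex_norm_square[symmetric])
  also have "1 = \<psi> (x + - x)" using additive_character_0[OF assms] by simp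
  also have "\<dots> = \<psi> x * \<psi> (- x)" by (rule additive_character_add[OF assms])
  finally show ?thesis using assms by (simp add: additive_character_def)
qed

lemma sum_additive_character:
  fixes \<psi> :: "'a::{field,finite} \<Rightarrow> complex"
  assumes "additive_character \<psi>" "nontrivial_character \<psi>"
  shows "(\<Sum>y\<in>UNIV. \<psi> (y * a)) = (if a = 0 then of_nat CARD('a) else 0)"
proof (cases "a = 0")
  case True
  then show ?thesis using additive_character_0[OF assms(1)] by simp
next
  case False
  obtain c where c: "\<psi> c \<noteq> 1" using assms(2) by (auto simp: nontrivial_character_def)
  have "(\<Sum>y\<in>UNIV. \<psi> y) = (\<Sum>y\<in>UNIV. \<psi> (c + y))"
    by (rule sum.reindex_bij_witness[of _ "\<lambda>y. c + y" "\<lambda>y. y - c"]) auto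
  also have "\<dots> = \<psi> c * (\<Sum>y\<in>UNIV. \<psi> y)"
    by (simp add: additive_character_add[OF assms(1)] sum_distrib_left)
  finally have "(\<Sum>y\<in>UNIV. \<psi> y) = 0" using c by simp
  moreover have "(\<Sum>y\<in>UNIV. \<psi> (y * a)) = (\<Sum>y\<in>UNIV. \<psi> y)"
    by (rule sum.reindex_bij_witness[of _ "\<lambda>y. y / a" "\<lambda>y. y * a"]) (use False in auto)
  ultimately show ?thesis using False by simp
qed

section \<open>Gauss sums\<close>

text \<open>
  The additive frequency \<open>l\<close> may be \<open>0\<close>, in which case this is the plain character sum: that
  value carries the main term of the theorem.
\<close>

definition gauss_sum ::
    "('a::{field,finite} \<Rightarrow> complex) \<Rightarrow> ('a \<Rightarrow> complex) \<Rightarrow> 'a \<Rightarrow> complex" where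
  "gauss_sum \<psi> chi l = (\<Sum>x\<in>UNIV - {0}. chi x * \<psi> (l * x))"

lemma gauss_sum_0:
  assumes "additive_character \<psi>"
  shows "gauss_sum \<psi> chi 0 = (\<Sum>x\<in>UNIV - {0}. chi x)"
  using additive_character_0[OF assms] by (simp add: gauss_sum_def)

lemma gauss_sum_scale:
  assumes "multiplicative_character chi" "l \<noteq> 0"
  shows "gauss_sum \<psi> chi l = gauss_sum \<psi> chi 1 / chi l"
proof -
  have "gauss_sum \<psi> chi 1 = (\<Sum>x\<in>UNIV - {0}. chi (l * x) * \<psi> (l * x))"
    using sum_nonzero_scale[OF assms(2), of "\<lambda>x. chi x * \<psi> x"] by (simp add: gauss_sum_def)
  also have "\<dots> = chi l * gauss_sum \<psi> chi l"
    using assms(2) by (simp add: gauss_sum_def multiplicative_character_times[OF assms(1)]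
        sum_distrib_left mult.assoc)
  finally show ?thesis using multiplicative_character_nonzero[OF assms] by simp
qed

text \<open>
  Parseval's identity for the function equal to \<open>chi\<close> on nonzero elements and to \<open>0\<close> at \<open>0\<close>,
  whose values have absolute value \<open>1\<close> at \<open>q - 1\<close> points.
\<close>

lemma gauss_sum_parseval:
  fixes \<psi> :: "'a::{field,finite} \<Rightarrow> complex"
  assumes "additive_character \<psi>" "nontrivial_character \<psi>" "multiplicative_character chi"
  shows "(\<Sum>l\<in>UNIV. (norm (gauss_sum \<psi> chi l))\<^sup>2) = real CARD('a) * (real CARD('a) - 1)"
proof -
  let ?F = "UNIV - {0::'a}"
  have "(\<Sum>l\<in>UNIV. complex_of_real ((norm (gauss_sum \<psi> chi l))\<^sup>2)) =
        (\<Sum>l\<in>UNIV. \<Sum>x\<in>?F. \<Sum>y\<in>?F. chi x * cnj (chi y) * \<psi> (l * (x - y)))"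
  proof (rule sum.cong[OF refl])
    fix l :: 'a
    have "\<psi> (l * x) * cnj (\<psi> (l * y)) = \<psi> (l * (x - y))" for x y
    proof -
      have "\<psi> (l * (x - y)) = \<psi> (l * x + - (l * y))" by (simp add: algebra_simps)
      also have "\<dots> = \<psi> (l * x) * \<psi> (- (l * y))"
        by (rule additive_character_add[OF assms(1)])
      finally show ?thesis by (simp add: cnj_additive_character[OF assms(1)])
    qed
    then have *: "chi x * \<psi> (l * x) * (cnj (chi y) * cnj (\<psi> (l * y))) =
          chi x * cnj (chi y) * \<psi> (l * (x - y))" for x y
      by (metis (no_types, lifting) mult.assoc mult.left_commute)
    show "complex_of_real ((norm (gauss_sum \<psi> chi l))\<^sup>2) =
        (\<Sum>x\<in>?F. \<Sum>y\<in>?F. chi x * cnj (chi y) * \<psi> (l * (x - y)))"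
      unfolding complex_norm_square gauss_sum_def
      by (simp only: cnj_sum complex_cnj_mult sum_product *)
  qed
  also have "\<dots> = (\<Sum>x\<in>?F. \<Sum>y\<in>?F. \<Sum>l\<in>UNIV. chi x * cnj (chi y) * \<psi> (l * (x - y)))"
    by (subst sum.swap, rule sum.cong[OF refl], rule sum.swap)
  also have "\<dots> = (\<Sum>x\<in>?F. \<Sum>y\<in>?F. if y = x then of_nat CARD('a) * (chi x * cnj (chi x)) else 0)"
    by (intro sum.cong refl)
       (simp add: sum_additive_character[OF assms(1,2)] flip: sum_distrib_left)
  also have "\<dots> = (\<Sum>x\<in>?F. of_nat CARD('a) * (chi x * cnj (chi x)))"
    by (intro sum.cong refl) (simp add: sum.delta)
  also have "\<dots> = (\<Sum>x\<in>?F. of_nat CARD('a))"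
    using norm_multiplicative_character[OF assms(3)]
    by (intro sum.cong refl) (simp add: complex_norm_square[symmetric])
  also have "\<dots> = complex_of_real (real CARD('a) * (real CARD('a) - 1))"
    by (simp add: card_Diff_subset of_nat_diff Suc_leI)
  finally show ?thesis by (simp only: of_real_eq_iff flip: of_real_sum)
qed

text \<open>
  The \<open>q - 1\<close> values at nonzero frequencies have the same absolute value, so each of their squares
  is at most \<open>1 / (q - 1)\<close> of the Parseval total \<open>q * (q - 1)\<close>. This treats trivial and
  nontrivial \<open>chi\<close> alike.
\<close>

lemma norm_gauss_sum_le:
  fixes \<psi> :: "'a::{field,finite} \<Rightarrow> complex"
  assumes "additive_character \<psi>" "nontrivial_character \<psi>" "multiplicative_character chi"
    and "l \<noteq> 0"
  shows "norm (gauss_sum \<psi> chi l) \<le> sqrt (real CARD('a))"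
proof -
  let ?q = "real CARD('a)"
  have const: "norm (gauss_sum \<psi> chi m) = norm (gauss_sum \<psi> chi 1)" if "m \<noteq> 0" for m
    using gauss_sum_scale[OF assms(3) that, of \<psi>] norm_multiplicative_character[OF assms(3) that]
    by (simp add: norm_divide)
  have "card {0, 1::'a} \<le> CARD('a)" by (intro card_mono) auto
  then have q: "?q > 1" by simp
  have "(?q - 1) * (norm (gauss_sum \<psi> chi 1))\<^sup>2 = (\<Sum>m\<in>UNIV - {0::'a}. (norm (gauss_sum \<psi> chi 1))\<^sup>2)"
    by (simp add: card_Diff_subset of_nat_diff Suc_leI)
  also have "\<dots> = (\<Sum>m\<in>UNIV - {0}. (norm (gauss_sum \<psi> chi m))\<^sup>2)"
  proof (rule sum.cong[OF refl])
    fix m :: 'a assume "m \<in> UNIV - {0}"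
    then show "(norm (gauss_sum \<psi> chi 1))\<^sup>2 = (norm (gauss_sum \<psi> chi m))\<^sup>2"
      using const[of m] by simp
  qed
  also have "\<dots> \<le> (\<Sum>m\<in>UNIV. (norm (gauss_sum \<psi> chi m))\<^sup>2)"
    by (intro sum_mono2) auto
  also have "\<dots> = (?q - 1) * ?q" using gauss_sum_parseval[OF assms(1-3)] by simp
  finally have "(norm (gauss_sum \<psi> chi 1))\<^sup>2 \<le> ?q" using q by simp
  then show ?thesis using const[OF assms(4)] by (simp add: real_le_rsqrt)
qed

section \<open>Fourier expansion of the inverted additive character\<close>

text \<open>
  The additive Fourier transform of \<open>t \<mapsto> \<psi> (1 / t)\<close>; for \<open>l \<noteq> 0\<close> it is a classical
  Kloosterman sum.
\<close>

definition inversion_transform :: "('a::{field,finite} \<Rightarrow> complex) \<Rightarrow> 'a \<Rightarrow> complex" where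
  "inversion_transform \<psi> l = (\<Sum>t\<in>UNIV - {0}. \<psi> (1 / t) * \<psi> (- (l * t)))"

lemma inversion_transform_0:
  fixes \<psi> :: "'a::{field,finite} \<Rightarrow> complex"
  assumes "additive_character \<psi>" "nontrivial_character \<psi>"
  shows "inversion_transform \<psi> 0 = - 1"
proof -
  have "inversion_transform \<psi> 0 = (\<Sum>t\<in>UNIV - {0}. \<psi> t)"
    using sum_nonzero_inverse[of \<psi>] additive_character_0[OF assms(1)]
    by (simp add: inversion_transform_def)
  also have "\<dots> = (\<Sum>t\<in>UNIV. \<psi> t) - \<psi> 0" by (simp add: sum_diff1)
  also have "\<dots> = - 1"
    using sum_additive_character[OF assms, of 1] additive_character_0[OF assms(1)] by simp
  finally show ?thesis .
qed

text \<open>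
  Fourier inversion. The value \<open>0\<close> at \<open>s = 0\<close> is what removes the tuples with vanishing sum from
  the inverted Kloosterman sum.
\<close>

lemma inversion_formula:
  fixes \<psi> :: "'a::{field,finite} \<Rightarrow> complex"
  assumes "additive_character \<psi>" "nontrivial_character \<psi>"
  shows "(\<Sum>l\<in>UNIV. inversion_transform \<psi> l * \<psi> (l * s)) =
           (if s = 0 then 0 else of_nat CARD('a) * \<psi> (1 / s))"
proof -
  have "\<psi> (- (l * t)) * \<psi> (l * s) = \<psi> (l * (s - t))" for l t
  proof -
    have "l * (s - t) = - (l * t) + l * s" by (simp add: algebra_simps)
    then show ?thesis by (simp only: additive_character_add[OF assms(1)])
  qed
  then have "(\<Sum>l\<in>UNIV. inversion_transform \<psi> l * \<psi> (l * s)) =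
        (\<Sum>l\<in>UNIV. \<Sum>t\<in>UNIV - {0}. \<psi> (1 / t) * \<psi> (l * (s - t)))"
    by (simp add: inversion_transform_def sum_distrib_right mult.assoc)
  also have "\<dots> = (\<Sum>t\<in>UNIV - {0}. \<psi> (1 / t) * (\<Sum>l\<in>UNIV. \<psi> (l * (s - t))))"
    by (subst sum.swap) (simp add: sum_distrib_left)
  also have "\<dots> = (\<Sum>t\<in>UNIV - {0}. if t = s then of_nat CARD('a) * \<psi> (1 / s) else 0)"
    by (intro sum.cong refl) (simp add: sum_additive_character[OF assms])
  also have "\<dots> = (if s = 0 then 0 else of_nat CARD('a) * \<psi> (1 / s))"
    by (simp add: sum.delta)
  finally show ?thesis .
qed

text \<open>
  Summing over \<open>l\<close> first gives \<open>\<psi> (1 / t)\<close> times the Gauss sum at frequency \<open>- t\<close>, which is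
  \<open>rho (1 / t)\<close> up to a constant; the substitution \<open>t \<mapsto> 1 / t\<close> turns the remaining sum into
  a second copy of the Gauss sum of \<open>rho\<close>.
\<close>

lemma inversion_transform_mellin:
  assumes "multiplicative_character rho"
  shows "(\<Sum>l\<in>UNIV - {0}. rho l * inversion_transform \<psi> l) =
           (gauss_sum \<psi> rho 1)\<^sup>2 / rho (- 1)"
proof -
  let ?G = "gauss_sum \<psi> rho 1"
  have "(\<Sum>l\<in>UNIV - {0}. rho l * inversion_transform \<psi> l) =
        (\<Sum>l\<in>UNIV - {0}. \<Sum>t\<in>UNIV - {0}. \<psi> (1 / t) * (rho l * \<psi> (- t * l)))"
    by (simp add: inversion_transform_def sum_distrib_left algebra_simps)
  also have "\<dots> = (\<Sum>t\<in>UNIV - {0}. \<psi> (1 / t) * gauss_sum \<psi> rho (- t))"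
    by (subst sum.swap) (simp only: gauss_sum_def sum_distrib_left)
  also have "\<dots> = (\<Sum>t\<in>UNIV - {0}. ?G / rho (- 1) * (rho (1 / t) * \<psi> (1 / t)))"
  proof (intro sum.cong refl)
    fix t :: 'a assume t: "t \<in> UNIV - {0}"
    have "rho (- t) = rho (- 1) * rho t"
      using multiplicative_character_times[OF assms, of "- 1" t] t by simp
    moreover have "gauss_sum \<psi> rho (- t) = ?G / rho (- t)"
      using gauss_sum_scale[OF assms, of "- t"] t by simp
    ultimately show "\<psi> (1 / t) * gauss_sum \<psi> rho (- t) =
        ?G / rho (- 1) * (rho (1 / t) * \<psi> (1 / t))"
      using t by (simp add: multiplicative_character_inverse[OF assms])
  qed
  also have "\<dots> = ?G / rho (- 1) * (\<Sum>t\<in>UNIV - {0}. rho t * \<psi> t)"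
    by (simp only: sum_nonzero_inverse[of "\<lambda>t. rho t * \<psi> t"] flip: sum_distrib_left)
  also have "\<dots> = ?G\<^sup>2 / rho (- 1)" by (simp add: gauss_sum_def power2_eq_square)
  finally show ?thesis .
qed

text \<open>
  For nonzero \<open>l\<close> the product of Gauss sums depends on \<open>l\<close> only through the character
  \<open>rho = 1 / (\<Prod>i. chi i)\<close>, so the sum is a Mellin transform of the inversion transform. Besides
  the \<open>card I\<close> Gauss sums this contributes two more, which account for the factor \<open>q\<close>.
\<close>

lemma norm_gauss_product_sum_le:
  fixes \<psi> :: "'a::{field,finite} \<Rightarrow> complex"
  assumes "additive_character \<psi>" "nontrivial_character \<psi>"
    and "\<And>i. i \<in> I \<Longrightarrow> multiplicative_character (chi i)"
  shows "norm (\<Sum>l\<in>UNIV - {0}. inversion_transform \<psi> l * (\<Prod>i\<in>I. gauss_sum \<psi> (chi i) l))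
           \<le> real CARD('a) * sqrt (real CARD('a)) ^ card I"
proof -
  define rho where "rho l = 1 / (\<Prod>i\<in>I. chi i l)" for l
  have rho: "multiplicative_character rho"
    unfolding rho_def using assms(3) by (rule multiplicative_character_reciprocal_prod)
  let ?P = "\<Prod>i\<in>I. gauss_sum \<psi> (chi i) 1"
  have scale: "(\<Prod>i\<in>I. gauss_sum \<psi> (chi i) l) = rho l * ?P" if "l \<noteq> 0" for l
  proof -
    have "(\<Prod>i\<in>I. gauss_sum \<psi> (chi i) l) = (\<Prod>i\<in>I. gauss_sum \<psi> (chi i) 1 / chi i l)"
      using gauss_sum_scale[OF assms(3) that] by simp
    then show ?thesis by (simp add: rho_def prod_dividef)
  qed
  have "(\<Sum>l\<in>UNIV - {0}. inversion_transform \<psi> l * (\<Prod>i\<in>I. gauss_sum \<psi> (chi i) l)) =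
      (\<Sum>l\<in>UNIV - {0}. ?P * (rho l * inversion_transform \<psi> l))"
  proof (rule sum.cong[OF refl])
    fix l :: 'a assume "l \<in> UNIV - {0}"
    then show "inversion_transform \<psi> l * (\<Prod>i\<in>I. gauss_sum \<psi> (chi i) l) =
        ?P * (rho l * inversion_transform \<psi> l)"
      using scale[of l] by (simp only: mult_ac) simp
  qed
  also have "\<dots> = ?P * ((gauss_sum \<psi> rho 1)\<^sup>2 / rho (- 1))"
    by (simp only: inversion_transform_mellin[OF rho] flip: sum_distrib_left)
  finally have "norm (\<Sum>l\<in>UNIV - {0}. inversion_transform \<psi> l * (\<Prod>i\<in>I. gauss_sum \<psi> (chi i) l)) =
      (norm (gauss_sum \<psi> rho 1))\<^sup>2 * (\<Prod>i\<in>I. norm (gauss_sum \<psi> (chi i) 1))"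
    using norm_multiplicative_character[OF rho, of "- 1"]
    by (simp add: norm_mult norm_divide norm_power prod_norm)
  also have "\<dots> \<le> (sqrt (real CARD('a)))\<^sup>2 * (\<Prod>i\<in>I. sqrt (real CARD('a)))"
    using norm_gauss_sum_le[OF assms(1,2)] rho assms(3)
    by (intro mult_mono power_mono prod_mono prod_nonneg) auto
  finally show ?thesis by simp
qed

section \<open>Expansion of the inverted Kloosterman sum\<close>

text \<open>
  The average of \<open>E k ((\<Prod>i. x i) / b)\<close> over \<open>k\<close> is the indicator of the condition
  \<open>(\<Prod>i. x i) = b\<close>. Once the condition is replaced by this average, the coordinates of the tuple
  are independent and the sum factors.
\<close>

lemma twisted_sum_over_product_fibre:
  fixes \<psi> :: "'a::{field,finite} \<Rightarrow> complex" and chi :: "'i \<Rightarrow> 'a \<Rightarrow> complex"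
  assumes "additive_character \<psi>" and "finite I" and "b \<noteq> 0"
    and E: "\<And>k. multiplicative_character (E k)"
    and orth: "\<And>x. x \<noteq> 0 \<Longrightarrow>
           (\<Sum>k<CARD('a) - 1. E k x) = (if x = 1 then of_nat (CARD('a) - 1) else 0)"
  shows "of_nat (CARD('a) - 1) *
           (\<Sum>x\<in>{x \<in> I \<rightarrow>\<^sub>E (UNIV - {0}). (\<Prod>i\<in>I. x i) = b}.
              (\<Prod>i\<in>I. chi i (x i)) * \<psi> (l * (\<Sum>i\<in>I. x i))) =
         (\<Sum>k<CARD('a) - 1. E k (1 / b) * (\<Prod>i\<in>I. gauss_sum \<psi> (\<lambda>x. chi i x * E k x) l))"
proof -
  let ?N = "CARD('a) - 1"
  let ?P = "I \<rightarrow>\<^sub>E (UNIV - {0::'a})"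
  let ?t = "\<lambda>x. (\<Prod>i\<in>I. chi i (x i)) * \<psi> (l * (\<Sum>i\<in>I. x i))"
  have "finite ?P" using assms(2) by (intro finite_PiE) auto
  have "(\<Sum>k<?N. E k (1 / b) * (\<Prod>i\<in>I. gauss_sum \<psi> (\<lambda>x. chi i x * E k x) l)) =
        (\<Sum>k<?N. \<Sum>x\<in>?P. E k (1 / b) * (\<Prod>i\<in>I. chi i (x i) * E k (x i) * \<psi> (l * x i)))"
    by (simp add: gauss_sum_def prod_sum_PiE[OF assms(2)] sum_distrib_left)
  also have "\<dots> = (\<Sum>k<?N. \<Sum>x\<in>?P. ?t x * E k ((\<Prod>i\<in>I. x i) / b))"
  proof (intro sum.cong refl)
    fix k x assume x: "x \<in> ?P"
    then have nz: "x i \<noteq> 0" if "i \<in> I" for i using that by (auto simp: PiE_iff)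
    then have "(\<Prod>i\<in>I. x i) \<noteq> 0" using assms(2) by simp
    then have "E k ((\<Prod>i\<in>I. x i) * (1 / b)) = E k (\<Prod>i\<in>I. x i) * E k (1 / b)"
      using assms(3) by (intro multiplicative_character_times E) auto
    then have "E k ((\<Prod>i\<in>I. x i) / b) = (\<Prod>i\<in>I. E k (x i)) * E k (1 / b)"
      using multiplicative_character_prod[OF E, of I x k] nz by simp
    then show "E k (1 / b) * (\<Prod>i\<in>I. chi i (x i) * E k (x i) * \<psi> (l * x i)) =
        ?t x * E k ((\<Prod>i\<in>I. x i) / b)"
      by (simp add: prod.distrib sum_distrib_left additive_character_sum[OF assms(1)])
  qed
  also have "\<dots> = (\<Sum>x\<in>?P. ?t x * (\<Sum>k<?N. E k ((\<Prod>i\<in>I. x i) / b)))"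
    by (subst sum.swap) (simp add: sum_distrib_left)
  also have "\<dots> = (\<Sum>x\<in>?P. if (\<Prod>i\<in>I. x i) = b then of_nat ?N * ?t x else 0)"
  proof (intro sum.cong refl)
    fix x assume "x \<in> ?P"
    then have "(\<Prod>i\<in>I. x i) \<noteq> 0" using assms(2) by (auto simp: PiE_iff)
    then show "?t x * (\<Sum>k<?N. E k ((\<Prod>i\<in>I. x i) / b)) =
        (if (\<Prod>i\<in>I. x i) = b then of_nat ?N * ?t x else 0)"
      using assms(3) orth[of "(\<Prod>i\<in>I. x i) / b"] by auto
  qed
  also have "\<dots> = of_nat ?N * (\<Sum>x\<in>{x \<in> ?P. (\<Prod>i\<in>I. x i) = b}. ?t x)"
    unfolding sum.inter_filter[OF \<open>finite ?P\<close>, symmetric]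
    by (rule sum_distrib_left[symmetric])
  finally show ?thesis by simp
qed

lemma inverted_kloosterman_sum_fourier:
  fixes \<psi> :: "'a::{field,finite} \<Rightarrow> complex"
  assumes "additive_character \<psi>" "nontrivial_character \<psi>"
  shows "of_nat CARD('a) * inverted_kloosterman_sum n \<psi> chi b =
           (\<Sum>l\<in>UNIV. inversion_transform \<psi> l *
             (\<Sum>x\<in>{x \<in> {1..n+1} \<rightarrow>\<^sub>E (UNIV - {0}). (\<Prod>i\<in>{1..n+1}. x i) = b}.
                (\<Prod>i\<in>{1..n+1}. chi i (x i)) * \<psi> (l * (\<Sum>i\<in>{1..n+1}. x i))))"
proof -
  let ?Q = "{x \<in> {1..n+1} \<rightarrow>\<^sub>E (UNIV - {0::'a}). (\<Prod>i\<in>{1..n+1}. x i) = b}"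
  let ?c = "\<lambda>x. \<Prod>i\<in>{1..n+1}. chi i (x i)"
  let ?s = "\<lambda>x. \<Sum>i\<in>{1..n+1}. x i"
  have "finite ({1..n+1} \<rightarrow>\<^sub>E (UNIV - {0::'a}))" by (intro finite_PiE) auto
  then have fin: "finite ?Q" by simp
  have "(\<Sum>l\<in>UNIV. inversion_transform \<psi> l * (\<Sum>x\<in>?Q. ?c x * \<psi> (l * ?s x))) =
        (\<Sum>x\<in>?Q. ?c x * (\<Sum>l\<in>UNIV. inversion_transform \<psi> l * \<psi> (l * ?s x)))"
    unfolding sum_distrib_left by (subst sum.swap) (intro sum.cong refl mult.left_commute)
  also have "\<dots> = (\<Sum>x\<in>?Q. if ?s x \<noteq> 0 then of_nat CARD('a) * (?c x * \<psi> (1 / ?s x)) else 0)"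
    by (intro sum.cong refl) (simp only: inversion_formula[OF assms], simp)
  also have "\<dots> = (\<Sum>x\<in>{x \<in> ?Q. ?s x \<noteq> 0}. of_nat CARD('a) * (?c x * \<psi> (1 / ?s x)))"
    using fin by (rule sum.inter_filter[symmetric])
  also have "{x \<in> ?Q. ?s x \<noteq> 0} = {x \<in> {1..n+1} \<rightarrow>\<^sub>E (UNIV - {0::'a}).
      (\<Prod>i\<in>{1..n+1}. x i) = b \<and> ?s x \<noteq> 0}" by auto
  finally show ?thesis
    by (simp only: inverted_kloosterman_sum_def sum_distrib_left)
qed

text \<open>
  Up to the factor \<open>- 1 / q\<close>, the quantity \<open>M\<close> is the contribution of the frequency \<open>l = 0\<close>,
  which is the only place where it matters whether the characters \<open>chi i\<close> agree. The other
  frequencies together are bounded for each \<open>k\<close> by \<open>norm_gauss_product_sum_le\<close>.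
\<close>

lemma inverted_kloosterman_sum_estimate:
  fixes \<psi> :: "'a::{field,finite} \<Rightarrow> complex"
  assumes "additive_character \<psi>" "nontrivial_character \<psi>" and "b \<noteq> 0"
    and chi: "\<And>i. i \<in> {1..n+1} \<Longrightarrow> multiplicative_character (chi i)"
    and E: "\<And>k. multiplicative_character (E k)"
    and orth: "\<And>x. x \<noteq> 0 \<Longrightarrow>
           (\<Sum>k<CARD('a) - 1. E k x) = (if x = 1 then of_nat (CARD('a) - 1) else 0)"
    and M: "(\<Sum>k<CARD('a) - 1. E k (1 / b) * (\<Prod>i\<in>{1..n+1}. \<Sum>x\<in>UNIV - {0}. chi i x * E k x))
            = of_nat (CARD('a) - 1) * M"
  shows "norm (inverted_kloosterman_sum n \<psi> chi b + M / of_nat CARD('a))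
           \<le> real CARD('a) powr ((real n + 1) / 2)"
proof -
  let ?q = "CARD('a)" and ?I = "{1..n+1}"
  let ?N = "?q - 1"
  let ?K = "inversion_transform \<psi>"
  let ?S = "inverted_kloosterman_sum n \<psi> chi b"
  have "card {0, 1::'a} \<le> ?q" by (intro card_mono) auto
  then have q: "?q > 0" "?N > 0" by simp_all
  define G where "G k l = (\<Prod>i\<in>?I. gauss_sum \<psi> (\<lambda>x. chi i x * E k x) l)" for k l
  define T where "T l = (\<Sum>x\<in>{x \<in> ?I \<rightarrow>\<^sub>E (UNIV - {0}). (\<Prod>i\<in>?I. x i) = b}.
      (\<Prod>i\<in>?I. chi i (x i)) * \<psi> (l * (\<Sum>i\<in>?I. x i)))" for l
  have T: "of_nat ?N * T l = (\<Sum>k<?N. E k (1 / b) * G k l)" for l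
    unfolding T_def G_def
    by (rule twisted_sum_over_product_fibre[OF assms(1) finite_atLeastAtMost assms(3)])
       (fact E orth)+
  have "of_nat ?N * (of_nat ?q * ?S) = (\<Sum>l\<in>UNIV. ?K l * (of_nat ?N * T l))"
    unfolding inverted_kloosterman_sum_fourier[OF assms(1,2), of n chi b, folded T_def]
    by (simp only: sum_distrib_left mult.left_commute)
  also have "\<dots> = (\<Sum>l\<in>UNIV. ?K l * (\<Sum>k<?N. E k (1 / b) * G k l))"
    by (simp only: T)
  also have "\<dots> = ?K 0 * (\<Sum>k<?N. E k (1 / b) * G k 0) +
      (\<Sum>l\<in>UNIV - {0}. ?K l * (\<Sum>k<?N. E k (1 / b) * G k l))"
    by (rule sum.remove) auto
  also have "(\<Sum>k<?N. E k (1 / b) * G k 0) = of_nat ?N * M"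
    unfolding G_def gauss_sum_0[OF assms(1)] by (rule M)
  also have "(\<Sum>l\<in>UNIV - {0}. ?K l * (\<Sum>k<?N. E k (1 / b) * G k l)) =
      (\<Sum>k<?N. E k (1 / b) * (\<Sum>l\<in>UNIV - {0}. ?K l * G k l))" (is "_ = ?R")
    unfolding sum_distrib_left by (subst sum.swap) (simp add: mult.left_commute)
  finally have eq: "of_nat ?N * of_nat ?q * (?S + M / of_nat ?q) = ?R"
    using q inversion_transform_0[OF assms(1,2)] by (simp add: algebra_simps)
  have "norm ?R \<le> (\<Sum>k<?N. real ?q * sqrt (real ?q) ^ card ?I)"
  proof (rule sum_norm_le)
    fix k
    have "norm (E k (1 / b)) = 1"
      using norm_multiplicative_character[OF E] assms(3) by simp
    moreover have "norm (\<Sum>l\<in>UNIV - {0}. ?K l * G k l) \<le> real ?q * sqrt (real ?q) ^ card ?I"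
      unfolding G_def using chi E
      by (intro norm_gauss_product_sum_le assms(1,2) multiplicative_character_mult) auto
    ultimately show "norm (E k (1 / b) * (\<Sum>l\<in>UNIV - {0}. ?K l * G k l))
        \<le> real ?q * sqrt (real ?q) ^ card ?I"
      by (simp add: norm_mult)
  qed
  also have "\<dots> = (real ?N * real ?q) * sqrt (real ?q) ^ (n + 1)" by simp
  finally have "norm ?R \<le> (real ?N * real ?q) * sqrt (real ?q) ^ (n + 1)" .
  moreover have "norm ?R = (real ?N * real ?q) * norm (?S + M / of_nat ?q)"
    unfolding eq[symmetric] by (simp add: norm_mult del: of_nat_diff)
  ultimately have "norm (?S + M / of_nat ?q) \<le> sqrt (real ?q) ^ (n + 1)"
    using q by (simp add: mult_le_cancel_left_pos del: of_nat_diff)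
  also have "sqrt (real ?q) ^ (n + 1) = (real ?q powr (1/2)) powr real (n + 1)"
    using q by (simp only: powr_half_sqrt powr_realpow of_nat_0_le_iff real_sqrt_gt_zero of_nat_0_less_iff)
  also have "\<dots> = real ?q powr ((real n + 1) / 2)"
    by (simp add: powr_powr algebra_simps)
  finally show ?thesis .
qed

section \<open>The bound\<close>

text \<open>
  It remains to evaluate the contribution of \<open>l = 0\<close>. When all characters agree, exactly one \<open>k\<close>
  makes \<open>chi 1\<close> times \<open>E k\<close> trivial. This count is read off from orthogonality: the sum of
  \<open>chi 1 x * E k x\<close> over nonzero \<open>x\<close> is \<open>q - 1\<close> for such a \<open>k\<close> and \<open>0\<close> for every other \<open>k\<close>,
  and exchanging the order of summation shows that these sums add up to \<open>q - 1\<close>.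
\<close>

theorem theorem1p1:
  fixes n :: nat
    and b :: "'a::{field,finite}"
    and \<psi> :: "'a \<Rightarrow> complex"
    and chi :: "nat \<Rightarrow> 'a \<Rightarrow> complex"
  assumes "n \<ge> 1"
    and "b \<noteq> 0"
    and "additive_character \<psi>"
    and "nontrivial_character \<psi>"
    and "\<forall>i\<in>{1..n+1}. multiplicative_character (chi i)"
  shows
    "((\<forall>i\<in>{1..n+1}. \<forall>j\<in>{1..n+1}. same_character (chi i) (chi j)) \<longrightarrow>
        norm (inverted_kloosterman_sum n \<psi> chi b
              + of_real ((real CARD('a) - 1) ^ n / real CARD('a)) * chi 1 b)
          \<le> real CARD('a) powr ((real n + 1) / 2)) \<and>
     ((\<exists>i\<in>{1..n+1}. \<exists>j\<in>{1..n+1}. i \<noteq> j \<and> \<not> same_character (chi i) (chi j)) \<longrightarrow>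
        norm (inverted_kloosterman_sum n \<psi> chi b)
          \<le> real CARD('a) powr ((real n + 1) / 2))"
proof -
  let ?N = "CARD('a) - 1"
  let ?F = "UNIV - {0::'a}"
  have chi: "multiplicative_character (chi i)" if "i \<in> {1..n+1}" for i
    using assms(5) that by blast
  obtain E :: "nat \<Rightarrow> 'a \<Rightarrow> complex" where E: "\<And>k. multiplicative_character (E k)"
    and orth: "\<And>x. x \<noteq> 0 \<Longrightarrow> (\<Sum>k<?N. E k x) = (if x = 1 then of_nat ?N else 0)"
    using orthogonal_character_family by blast
  define A where "A i k = (\<Sum>x\<in>?F. chi i x * E k x)" for i k
  have estimate: "norm (inverted_kloosterman_sum n \<psi> chi b + M / of_nat CARD('a))
      \<le> real CARD('a) powr ((real n + 1) / 2)"
    if "(\<Sum>k<?N. E k (1 / b) * (\<Prod>i\<in>{1..n+1}. A i k)) = of_nat ?N * M" for M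
    by (rule inverted_kloosterman_sum_estimate[OF assms(3,4,2) chi _ _ that[unfolded A_def]])
       (assumption | fact E orth)+
  have A: "A i k = (if \<forall>x. x \<noteq> 0 \<longrightarrow> chi i x * E k x = 1 then of_nat ?N else 0)"
    if "i \<in> {1..n+1}" for i k
    unfolding A_def
    by (rule sum_multiplicative_character[OF multiplicative_character_mult[OF chi[OF that] E]])
  show ?thesis
  proof (intro conjI impI)
    assume same: "\<forall>i\<in>{1..n+1}. \<forall>j\<in>{1..n+1}. same_character (chi i) (chi j)"
    (* Both sides vanish unless chi 1 times E k is trivial. Keeping one factor A 1 k on the right
       lets orthogonality evaluate the sum over k. *)
    have "E k (1 / b) * (\<Prod>i\<in>{1..n+1}. A i k) = chi 1 b * of_nat ?N ^ n * A 1 k" for k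
    proof -
      have "(\<Prod>i\<in>{1..n+1}. A i k) = (\<Prod>i\<in>{1..n+1}. A 1 k)"
      proof (rule prod.cong[OF refl])
        fix i assume "i \<in> {1..n+1}"
        then have "same_character (chi i) (chi 1)" using same by simp
        then show "A i k = A 1 k"
          unfolding A_def by (intro sum.cong refl) (simp add: same_character_def)
      qed
      then have prod: "(\<Prod>i\<in>{1..n+1}. A i k) = A 1 k ^ n * A 1 k" by simp
      show ?thesis
      proof (cases "\<forall>x. x \<noteq> 0 \<longrightarrow> chi 1 x * E k x = 1")
        case True
        then have "E k (1 / b) = chi 1 b"
          using assms(2) multiplicative_character_inverse[OF E, of b k]
            multiplicative_character_nonzero[OF E, of b k] by (simp add: divide_eq_eq)
        then show ?thesis using True A[of 1 k] prod by simp
      next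
        case False
        then have "A 1 k = 0" by (subst A) auto
        then show ?thesis using prod by simp
      qed
    qed
    then have "(\<Sum>k<?N. E k (1 / b) * (\<Prod>i\<in>{1..n+1}. A i k)) =
        chi 1 b * of_nat ?N ^ n * (\<Sum>k<?N. A 1 k)"
      by (simp add: sum_distrib_left)
    also have "(\<Sum>k<?N. A 1 k) = (\<Sum>x\<in>?F. chi 1 x * (\<Sum>k<?N. E k x))"
      unfolding A_def by (subst sum.swap) (simp add: sum_distrib_left)
    also have "\<dots> = (\<Sum>x\<in>?F. if x = 1 then of_nat ?N else 0)"
    proof (rule sum.cong[OF refl])
      fix x :: 'a assume "x \<in> ?F"
      then show "chi 1 x * (\<Sum>k<?N. E k x) = (if x = 1 then of_nat ?N else 0)"
        using multiplicative_character_1[OF chi, of 1] by (subst orth) auto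
    qed
    also have "\<dots> = of_nat ?N" by (simp add: sum.delta)
    finally have "(\<Sum>k<?N. E k (1 / b) * (\<Prod>i\<in>{1..n+1}. A i k)) =
        of_nat ?N * (chi 1 b * of_nat ?N ^ n)" by simp
    from estimate[OF this]
    have "norm (inverted_kloosterman_sum n \<psi> chi b + chi 1 b * of_nat ?N ^ n / of_nat CARD('a))
        \<le> real CARD('a) powr ((real n + 1) / 2)" by simp
    moreover have "chi 1 b * of_nat ?N ^ n / of_nat CARD('a) =
        of_real ((real CARD('a) - 1) ^ n / real CARD('a)) * chi 1 b"
      by (simp add: of_nat_diff Suc_leI)
    ultimately show "norm (inverted_kloosterman_sum n \<psi> chi b
              + of_real ((real CARD('a) - 1) ^ n / real CARD('a)) * chi 1 b)
          \<le> real CARD('a) powr ((real n + 1) / 2)" by (simp only:)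
  next
    assume "\<exists>i\<in>{1..n+1}. \<exists>j\<in>{1..n+1}. i \<noteq> j \<and> \<not> same_character (chi i) (chi j)"
    then obtain i j x where ij: "i \<in> {1..n+1}" "j \<in> {1..n+1}" "x \<noteq> 0" "chi i x \<noteq> chi j x"
      by (auto simp: same_character_def)
    have "(\<Prod>i\<in>{1..n+1}. A i k) = 0" for k
    proof -
      have "chi i x * E k x \<noteq> 1 \<or> chi j x * E k x \<noteq> 1"
        using ij(4) multiplicative_character_nonzero[OF E ij(3), of k]
        by (metis mult_cancel_right)
      then have "A i k = 0 \<or> A j k = 0" using A ij(1-3) by auto
      then show ?thesis using ij(1,2) by (intro prod_zero) auto
    qed
    then have "(\<Sum>k<?N. E k (1 / b) * (\<Prod>i\<in>{1..n+1}. A i k)) = of_nat ?N * 0"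
      by (simp only: mult_zero_right sum.neutral_const)
    from estimate[OF this]
    show "norm (inverted_kloosterman_sum n \<psi> chi b)
        \<le> real CARD('a) powr ((real n + 1) / 2)" by simp
  qed
qed

end
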